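(* Let $N\ge 1$, let $\lambda$ be a partition of $N$, let $\lambda^t$ be the conjugate partition, and let $D^{\lambda}$, $D^{\lambda^t}$ be the Young-Yamanouchi irreducible representations of the symmetric group $S(N)$, with orthonormal bases $\{|T\rangle\}$ indexed by the standard Young tableaux $T$ of shape $\lambda$, respectively of shape $\lambda^t$. Let $d_\lambda$ be the number of standard Young tableaux of shape $\lambda$, listed as $T^1_\lambda,\ldots,T^{d_\lambda}_\lambda$ in increasing lexicographic order of their row Yamanouchi symbols, and let $\sigma_i\in S(N)$ be the unique permutation with $\sigma_i(T^1_\lambda)=T^i_\lambda$. Then the operator $$U=\sum_{i=1}^{d_\lambda}\operatorname{sgn}(\sigma_i)\,|(T^i_{\lambda})^{t}\rangle\langle T^i_\lambda|$$ (that is, $U|T^i_\lambda\rangle=\operatorname{sgn}(\sigma_i)|(T^i_\lambda)^t\rangle$) from the space of $D^\lambda$ to the space of $D^{\lambda^t}$ is unitary and defines the similarity transformation $$D^{\lambda^t}(\sigma)=\operatorname{sgn}(\sigma)\,U D^{\lambda}(\sigma)U^{\dagger}\qquad\text{for all }\sigma\in S(N).$$ Moreover, if both bases are ordered by increasing lexicographic order of row Yamanouchi symbols, giving $e_1,\ldots,e_{d_\lambda}$ for $\lambda$ and $f_1,\ldots,f_{d_\lambda}$ for $\lambda^t$, then the matrix $(U_{ij})$ of $U$, with the convention $U(e_i)=\sum_j U_{ij}f_j$, is anti-diagonal with entries $\pm1$: $$(U_{ij})=\begin{pmatrix} 0 & 0 & \cdots & 0 & \operatorname{sgn}(\sigma_1)\\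 0 & 0 & \cdots & \operatorname{sgn}(\sigma_2) & 0\\ \vdots & & ⋰ & & \vdots\\ 0 & \operatorname{sgn}(\sigma_{d_\lambda-1}) & \cdots & 0 & 0\\ \operatorname{sgn}(\sigma_{d_\lambda}) & 0 & \cdots & 0 & 0\end{pmatrix},$$ i.e. $U_{ij}=\operatorname{sgn}(\sigma_i)$ if $i+j=d_\lambda+1$ and $U_{ij}=0$ otherwise.
   Context: A Young diagram of a partition $\lambda=(\lambda_1\ge\lambda_2\ge\cdots)$ of $N$ has $\lambda_i$ left-justified boxes in row $i$ (rows numbered from the top). A Young tableau of shape $\lambda$ is a bijective filling of the boxes with $1,\ldots,N$; it is standard if entries increase to the right along rows and downwards along columns. The conjugate partition $\lambda^t$ (and the conjugate tableau $T^t$) is obtained by interchanging rows and columns (carrying along the entries). A permutation $\sigma\in S(N)$ acts on a Young tableau by replacing each entry $m$ with $\sigma(m)$. Row Yamanouchi symbol of a standard tableau $T$: the sequence $(M_1,\ldots,M_N)$, where $M_m$ is the number of the row of $T$ containing $m$. Symbols are compared lexicographically: $M<M'$ if for some $j$, $M_i=M'_i$ for all $i<j$ and $M_j<M'_j$. Thus $T^1_\lambda$ is the tableau filled row by row with $1,2,\ldots,N$. Axial distance: $\rho(T;i,j)$ is the signed number of horizontal and vertical steps to go from the box containing $i$ to the box containing $j$ in $T$, where each step down or to the left counts $+1$ and each step up or to the right counts $-1$. Young-Yamanouchi representation $D^\lambda$ of $S(N)$: the representation on the complex Hilbert space with orthonormal basis $\{|T\rangle : T \text{ a standard Young tableau of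 shape }\lambda\}$ determined on the generators $(k\ k+1)$, $k=1,\ldots,N-1$, by $$D^{\lambda}(k\ k+1)|T\rangle=\frac{1}{\rho(T;k+1,k)}|T\rangle+\sqrt{1-\frac{1}{\rho(T;k+1,k)^2}}\;|(k\ k+1)T\rangle,$$ where the second term appears only if $(k\ k+1)T$ is a standard Young tableau. It is a standard fact that this defines an irreducible unitary representation of $S(N)$. *)

theory Defs
  imports
    "Jordan_Normal_Form.Schur_Decomposition"
    "HOL-Algebra.Sym_Groups"
    "HOL-Library.List_Lexorder"
begin

text \<open>
  A partition is the weakly decreasing, finitely supported sequence of its row lengths. Rows,
  columns and the positions of a list are numbered from 0; the entries of a tableau of size
  \<open>N\<close> are \<open>1, \<dots>, N\<close>.
\<close>

definition is_partition :: "nat \<Rightarrow> (nat \<Rightarrow> nat) \<Rightarrow> bool" where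
  "is_partition N lam \<longleftrightarrow>
     antimono lam \<and> finite {i. lam i \<noteq> 0} \<and> (\<Sum>i | lam i \<noteq> 0. lam i) = N"

definition boxes :: "(nat \<Rightarrow> nat) \<Rightarrow> (nat \<times> nat) set" where
  "boxes lam = {(i, j). j < lam i}"

definition conj_partition :: "(nat \<Rightarrow> nat) \<Rightarrow> nat \<Rightarrow> nat" where
  "conj_partition lam j = card {i. j < lam i}"

text \<open>
  A tableau is extended by the value 0 outside its diagram, so that it is determined by its filling.
  As a permutation of \<open>{1..N}\<close> fixes 0, the action of \<open>p\<close> on a tableau
  \<open>T\<close> is the composition \<open>p \<circ> T\<close>.
\<close>

definition is_tableau :: "nat \<Rightarrow> (nat \<Rightarrow> nat) \<Rightarrow> (nat \<times> nat \<Rightarrow> nat) \<Rightarrow> bool" where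
  "is_tableau N lam T \<longleftrightarrow>
     bij_betw T (boxes lam) {1..N} \<and> (\<forall>b. b \<notin> boxes lam \<longrightarrow> T b = 0)"

definition syt :: "nat \<Rightarrow> (nat \<Rightarrow> nat) \<Rightarrow> (nat \<times> nat \<Rightarrow> nat) set" where
  "syt N lam = {T. is_tableau N lam T \<and>
     (\<forall>i j j'. (i, j) \<in> boxes lam \<and> (i, j') \<in> boxes lam \<and> j < j' \<longrightarrow> T (i, j) < T (i, j')) \<and>
     (\<forall>i i' j. (i, j) \<in> boxes lam \<and> (i', j) \<in> boxes lam \<and> i < i' \<longrightarrow> T (i, j) < T (i', j))}"

definition conj_tableau :: "(nat \<times> nat \<Rightarrow> nat) \<Rightarrow> nat \<times> nat \<Rightarrow> nat" where
  "conj_tableau T = (\<lambda>(i, j). T (j, i))"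

definition box_of :: "(nat \<times> nat \<Rightarrow> nat) \<Rightarrow> nat \<Rightarrow> nat \<times> nat" where
  "box_of T m = (THE b. T b = m)"

definition axial_distance :: "(nat \<times> nat \<Rightarrow> nat) \<Rightarrow> nat \<Rightarrow> nat \<Rightarrow> int" where
  "axial_distance T i j =
     (int (fst (box_of T j)) - int (fst (box_of T i)))
     - (int (snd (box_of T j)) - int (snd (box_of T i)))"

definition yamanouchi :: "nat \<Rightarrow> (nat \<times> nat \<Rightarrow> nat) \<Rightarrow> nat list" where
  "yamanouchi N T = map (\<lambda>m. Suc (fst (box_of T m))) [1..<Suc N]"

text \<open>The order on \<open>nat list\<close> is the lexicographic one of \<^theory>\<open>HOL-Library.List_Lexorder\<close>.\<close>

definition syt_list :: "nat \<Rightarrow> (nat \<Rightarrow> nat) \<Rightarrow> (nat \<times> nat \<Rightarrow> nat) list" where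
  "syt_list N lam = sorted_key_list_of_set (yamanouchi N) (syt N lam)"

definition syt_perm :: "nat \<Rightarrow> (nat \<Rightarrow> nat) \<Rightarrow> nat \<Rightarrow> nat \<Rightarrow> nat" where
  "syt_perm N lam i =
     (THE p. p permutes {1..N} \<and> p \<circ> syt_list N lam ! 0 = syt_list N lam ! i)"

text \<open>
  The representation space of shape \<open>lam\<close> is the space of complex column vectors of
  dimension \<open>dim_syt N lam\<close> with its standard inner product;
  \<open>ket N lam T\<close> is the standard basis vector at the position of \<open>T\<close> in
  \<open>syt_list N lam\<close>.
\<close>

definition dim_syt :: "nat \<Rightarrow> (nat \<Rightarrow> nat) \<Rightarrow> nat" where
  "dim_syt N lam = card (syt N lam)"

definition ket :: "nat \<Rightarrow> (nat \<Rightarrow> nat) \<Rightarrow> (nat \<times> nat \<Rightarrow> nat) \<Rightarrow> complex vec" where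
  "ket N lam T = vec (dim_syt N lam) (\<lambda>i. if syt_list N lam ! i = T then 1 else 0)"

text \<open>
  The adjacent transpositions generate the symmetric group, so at most one homomorphism
  \<open>D\<close> satisfies the following up to its values outside the group.
\<close>

definition young_yamanouchi_rep ::
    "nat \<Rightarrow> (nat \<Rightarrow> nat) \<Rightarrow> ((nat \<Rightarrow> nat) \<Rightarrow> complex mat) \<Rightarrow> bool" where
  "young_yamanouchi_rep N lam D \<longleftrightarrow>
     D \<in> hom (sym_group N) (units_of (ring_mat TYPE(complex) (dim_syt N lam) ())) \<and>
     (\<forall>k \<in> {1..<N}. \<forall>T \<in> syt N lam.
        let s = Transposition.transpose k (k + 1);
            r = real_of_int (axial_distance T (k + 1) k)
        in D s *\<^sub>v ket N lam T =
             complex_of_real (1 / r) \<cdot>\<^sub>v ket N lam T +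
             (if s \<circ> T \<in> syt N lam
              then complex_of_real (sqrt (1 - 1 / r\<^sup>2)) \<cdot>\<^sub>v ket N lam (s \<circ> T)
              else 0\<^sub>v (dim_syt N lam)))"

text \<open>Entries of the sum of the operators \<open>sgn(\<sigma>\<^sub>i) |T\<^sub>i\<^sup>t\<rangle>\<langle>T\<^sub>i|\<close>.\<close>

definition conj_op :: "nat \<Rightarrow> (nat \<Rightarrow> nat) \<Rightarrow> complex mat" where
  "conj_op N lam =
     mat (dim_syt N (conj_partition lam)) (dim_syt N lam) (\<lambda>(a, b).
       \<Sum>i < dim_syt N lam. of_int (sign (syt_perm N lam i)) *
         (ket N (conj_partition lam) (conj_tableau (syt_list N lam ! i)) $ a *
          conjugate (ket N lam (syt_list N lam ! i) $ b)))"

definition unitary_op :: "nat \<Rightarrow> nat \<Rightarrow> complex mat \<Rightarrow> bool" where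
  "unitary_op n m U \<longleftrightarrow>
     U \<in> carrier_mat m n \<and> mat_adjoint U * U = 1\<^sub>m n \<and> U * mat_adjoint U = 1\<^sub>m m"

text \<open>
  \<open>A\<close> collects the coefficients of \<open>X\<close> in the convention
  \<open>X(e\<^sub>i) = \<Sum>\<^sub>j A\<^sub>i\<^sub>j f\<^sub>j\<close>, in which the coefficients of the image of
  \<open>e\<^sub>i\<close> form a row.
\<close>

definition is_row_matrix_of ::
    "nat \<Rightarrow> (nat \<Rightarrow> nat) \<Rightarrow> (nat \<Rightarrow> nat) \<Rightarrow> complex mat \<Rightarrow> complex mat \<Rightarrow> bool" where
  "is_row_matrix_of N lam mu X A \<longleftrightarrow>
     A \<in> carrier_mat (dim_syt N lam) (dim_syt N mu) \<and>
     (\<forall>i < dim_syt N lam.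
        X *\<^sub>v ket N lam (syt_list N lam ! i) =
          finsum_vec TYPE(complex) (dim_syt N mu)
            (\<lambda>j. A $$ (i, j) \<cdot>\<^sub>v ket N mu (syt_list N mu ! j)) {..<dim_syt N mu})"

end

theory Submission
  imports Defs
begin

text \<open>
  Transposing a tableau negates all axial distances, so an adjacent transposition
  \<open>s\<close> acts on \<open>|T\<^sup>t\<rangle>\<close> with the opposite diagonal coefficient and the same off-diagonal
  one as on \<open>|T\<rangle>\<close>. As \<open>sT\<close> and \<open>T\<close> are reached from the first tableau by permutations of opposite
  signs, this means \<open>D'(s) U = - U D(s)\<close>, and the adjacent transpositions generate the group.
  The matrix of \<open>U\<close> is anti-diagonal because transposition reverses the lexicographic order: at the
  first entry where two tableaux differ, the one placing it higher places it further to the right.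
\<close>

section \<open>Conjugation of diagrams and tableaux\<close>

text \<open>Row lengths decrease weakly, so the rows meeting column \<open>i\<close> form an initial
  segment of the naturals, and such a finite segment has more than \<open>j\<close> elements exactly
  when it contains \<open>j\<close>.\<close>

lemma boxes_conj:
  assumes "is_partition N lam"
  shows "(i, j) \<in> boxes (conj_partition lam) \<longleftrightarrow> (j, i) \<in> boxes lam"
proof -
  let ?S = "{r. i < lam r}"
  have fin: "finite ?S"
    by (rule finite_subset[of _ "{r. lam r \<noteq> 0}"]) (use assms in \<open>auto simp: is_partition_def\<close>)
  have down: "r \<in> ?S" if "r \<le> s" "s \<in> ?S" for r s
    using assms that by (auto simp: is_partition_def dest!: antimonoD[of lam r s])
  have "j < card ?S \<longleftrightarrow> j \<in> ?S"
  proof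
    assume "j < card ?S"
    then obtain s where "s \<in> ?S" "j \<le> s"
      using card_mono[of "{..<j}" ?S] by (force simp: not_less)
    then show "j \<in> ?S"
      using down by blast
  next
    assume "j \<in> ?S"
    then have "{..j} \<subseteq> ?S"
      using down by blast
    then show "j < card ?S"
      using card_mono[OF fin, of "{..j}"] by auto
  qed
  then show ?thesis
    by (auto simp: boxes_def conj_partition_def)
qed

lemma boxes_eq_Sigma: "boxes lam = (SIGMA i:{i. lam i \<noteq> 0}. {..<lam i})"
  by (auto simp: boxes_def)

lemma finite_boxes:
  assumes "is_partition N lam"
  shows "finite (boxes lam)"
  using assms by (auto simp: boxes_eq_Sigma is_partition_def intro!: finite_SigmaI)

text \<open>Finite support suffices here, so the count can be applied to the conjugate sequence
  while that is still being shown to be a partition.\<close>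

lemma card_boxes:
  assumes "finite {i. lam i \<noteq> 0}"
  shows "card (boxes lam) = (\<Sum>i | lam i \<noteq> 0. lam i)"
  using assms by (simp add: boxes_eq_Sigma card_SigmaI)

lemma is_partition_conj:
  assumes "is_partition N lam"
  shows "is_partition N (conj_partition lam)"
proof -
  have swap: "boxes (conj_partition lam) = prod.swap ` boxes lam"
    using boxes_conj[OF assms] by force
  \<comment> \<open>Every nonempty row has a box in column 0, so the support is contained in a
    projection of a finite diagram.\<close>
  have "(j, 0) \<in> boxes (conj_partition lam)" if "conj_partition lam j \<noteq> 0" for j
    using that by (simp add: boxes_def)
  then have "{j. conj_partition lam j \<noteq> 0} \<subseteq> fst ` boxes (conj_partition lam)"
    by force
  then have fin: "finite {j. conj_partition lam j \<noteq> 0}"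
    by (rule finite_subset) (simp add: swap finite_boxes[OF assms])
  have "card (boxes (conj_partition lam)) = card (boxes lam)"
    unfolding swap by (rule card_image) (auto simp: inj_on_def)
  then have "(\<Sum>j | conj_partition lam j \<noteq> 0. conj_partition lam j) = N"
    using card_boxes[OF fin] card_boxes[of lam] assms by (simp add: is_partition_def)
  moreover have "antimono (conj_partition lam)"
  proof (rule antimonoI)
    fix j j' :: nat assume "j \<le> j'"
    moreover have "finite {i. j < lam i}"
      by (rule finite_subset[of _ "{i. lam i \<noteq> 0}"]) (use assms in \<open>auto simp: is_partition_def\<close>)
    ultimately show "conj_partition lam j' \<le> conj_partition lam j"
      unfolding conj_partition_def by (intro card_mono) auto
  qed
  ultimately show ?thesis
    using fin by (simp add: is_partition_def)
qed

lemma boxes_down_closed: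
  assumes "is_partition N lam" "(i', j') \<in> boxes lam" "i \<le> i'" "j \<le> j'"
  shows "(i, j) \<in> boxes lam"
  using assms by (auto simp: is_partition_def boxes_def dest!: antimonoD[of lam i i'])

section \<open>Transposition of tableaux\<close>

lemma conj_tableau_apply [simp]: "conj_tableau T (i, j) = T (j, i)"
  by (simp add: conj_tableau_def)

lemma conj_tableau_conj_tableau [simp]: "conj_tableau (conj_tableau T) = T"
  by (auto simp: fun_eq_iff)

lemma conj_tableau_comp: "conj_tableau (p \<circ> T) = p \<circ> conj_tableau T"
  by (auto simp: fun_eq_iff)

lemma conj_tableau_eq_comp_swap: "conj_tableau T = T \<circ> prod.swap"
  by (auto simp: fun_eq_iff)

lemma conj_tableau_eq_iff [simp]: "conj_tableau T = conj_tableau S \<longleftrightarrow> T = S"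
  by (metis conj_tableau_conj_tableau)

lemma is_tableau_conj:
  assumes "is_partition N lam"
  shows "is_tableau N (conj_partition lam) (conj_tableau T) \<longleftrightarrow> is_tableau N lam T"
proof -
  have swap: "bij_betw prod.swap (boxes (conj_partition lam)) (boxes lam)"
    by (rule bij_betw_byWitness[where f' = prod.swap]) (use boxes_conj[OF assms] in auto)
  have "bij_betw (conj_tableau T) (boxes (conj_partition lam)) {1..N} \<longleftrightarrow>
      bij_betw T (boxes lam) {1..N}"
    unfolding conj_tableau_eq_comp_swap by (rule bij_betw_comp_iff[OF swap, symmetric])
  then show ?thesis
    using boxes_conj[OF assms] by (auto simp: is_tableau_def)
qed

lemma conj_tableau_in_syt_iff:
  assumes "is_partition N lam"
  shows "conj_tableau T \<in> syt N (conj_partition lam) \<longleftrightarrow> T \<in> syt N lam"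
  unfolding syt_def mem_Collect_eq is_tableau_conj[OF assms] boxes_conj[OF assms]
    conj_tableau_apply
  by auto

lemma syt_conj:
  assumes "is_partition N lam"
  shows "syt N (conj_partition lam) = conj_tableau ` syt N lam"
proof (intro equalityI subsetI)
  fix T assume "T \<in> syt N (conj_partition lam)"
  then have "conj_tableau T \<in> syt N lam"
    using conj_tableau_in_syt_iff[OF assms, of "conj_tableau T"] by simp
  then show "T \<in> conj_tableau ` syt N lam"
    by (metis conj_tableau_conj_tableau imageI)
qed (use conj_tableau_in_syt_iff[OF assms] in auto)

text \<open>The fixed value 0 outside the diagram leaves only finitely many boxes at which a tableau
  can vary.\<close>

lemma finite_syt:
  assumes "is_partition N lam"
  shows "finite (syt N lam)"
proof (rule finite_subset)
  let ?F = "{f. \<forall>b. (b \<in> boxes lam \<longrightarrow> f b \<in> {1..N}) \<and> (b \<notin> boxes lam \<longrightarrow> f b = 0)}"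
  show "syt N lam \<subseteq> ?F"
    by (auto simp: syt_def is_tableau_def dest!: bij_betwE)
  show "finite ?F"
    by (rule finite_set_of_finite_funs) (simp_all add: finite_boxes[OF assms])
qed

lemma dim_syt_conj:
  assumes "is_partition N lam"
  shows "dim_syt N (conj_partition lam) = dim_syt N lam"
  unfolding dim_syt_def syt_conj[OF assms] by (rule card_image) (simp add: inj_on_def)

text \<open>Injectivity on the diagram makes the description in \<open>box_of\<close> unique. The
  bound \<open>m \<ge> 1\<close> excludes 0, the value at every box outside the diagram.\<close>

lemma box_of_eqI:
  assumes "is_tableau N lam T" "T b = m" "m \<ge> 1"
  shows "box_of T m = b"
  unfolding box_of_def
proof (rule the_equality)
  fix c assume "T c = m"
  then have "c \<in> boxes lam" "b \<in> boxes lam"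
    using assms unfolding is_tableau_def by (metis not_one_le_zero)+
  then show "c = b"
    using assms \<open>T c = m\<close> by (metis bij_betw_imp_inj_on inj_on_def is_tableau_def)
qed (fact assms(2))

lemma box_of_tableau:
  assumes "is_tableau N lam T" "m \<in> {1..N}"
  shows "T (box_of T m) = m" "box_of T m \<in> boxes lam"
proof -
  obtain b where b: "b \<in> boxes lam" "T b = m"
    using assms by (metis bij_betw_iff_bijections is_tableau_def)
  then show "T (box_of T m) = m" "box_of T m \<in> boxes lam"
    using box_of_eqI[OF assms(1) b(2)] assms(2) by auto
qed

lemma box_of_conj_tableau:
  assumes "is_partition N lam" "is_tableau N lam T" "m \<in> {1..N}"
  shows "box_of (conj_tableau T) m = prod.swap (box_of T m)"
proof (rule box_of_eqI)
  show "is_tableau N (conj_partition lam) (conj_tableau T)"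
    using assms by (simp add: is_tableau_conj)
  show "conj_tableau T (prod.swap (box_of T m)) = m"
    using box_of_tableau(1)[OF assms(2,3)] by (simp add: conj_tableau_eq_comp_swap)
qed (use assms in simp)

text \<open>Transposition exchanges the row and the column difference, which enter the axial
  distance with opposite signs.\<close>

lemma axial_distance_conj_tableau:
  assumes "is_partition N lam" "is_tableau N lam T" "m \<in> {1..N}" "n \<in> {1..N}"
  shows "axial_distance (conj_tableau T) m n = - axial_distance T m n"
  using assms by (simp add: axial_distance_def box_of_conj_tableau)


section \<open>Conjugation reverses the order of the Yamanouchi symbols\<close>

lemma list_less_at_first_difference:
  fixes xs ys :: "'a :: order list"
  assumes "k < length xs" "length xs = length ys" "\<And>l. l < k \<Longrightarrow> xs ! l = ys ! l" "xs ! k < ys ! k"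
  shows "xs < ys"
  using assms
proof (induction xs arbitrary: ys k)
  case (Cons x xs)
  then obtain y ys' where ys: "ys = y # ys'"
    by (cases ys) auto
  show ?case
  proof (cases k)
    case (Suc k')
    have "xs ! l = ys' ! l" if "l < k'" for l
      using Cons.prems(3)[of "Suc l"] that ys Suc by simp
    then show ?thesis
      using Cons ys Suc Cons.prems(3)[of 0] by auto
  qed (use Cons.prems ys in auto)
qed simp

text \<open>Neither box of \<open>m\<close> can lie weakly above and weakly left of the other: the
  second tableau would have an entry at most \<open>m\<close> in the upper left box, but smaller
  entries sit at the same places in both tableaux and \<open>m\<close> itself sits elsewhere. So one
  box is strictly above and strictly right of the other.\<close>

lemma syt_first_difference:
  assumes lam: "is_partition N lam" and T: "T \<in> syt N lam" and S: "S \<in> syt N lam"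
    and m: "m \<in> {1..N}" and agree: "\<And>l. l \<in> {1..<m} \<Longrightarrow> box_of T l = box_of S l"
    and differ: "box_of T m \<noteq> box_of S m"
  shows "fst (box_of T m) < fst (box_of S m) \<and> snd (box_of S m) < snd (box_of T m) \<or>
    fst (box_of S m) < fst (box_of T m) \<and> snd (box_of T m) < snd (box_of S m)"
proof -
  have not_dominated: "\<not> (fst (box_of U m) \<le> fst (box_of V m) \<and> snd (box_of U m) \<le> snd (box_of V m))"
    if U: "U \<in> syt N lam" and V: "V \<in> syt N lam" and ne: "box_of U m \<noteq> box_of V m"
      and ag: "\<And>l. l \<in> {1..<m} \<Longrightarrow> box_of U l = box_of V l" for U V
  proof
    obtain i j where u: "box_of U m = (i, j)" by fastforce
    obtain i' j' where v: "box_of V m = (i', j')" by fastforce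
    assume "fst (box_of U m) \<le> fst (box_of V m) \<and> snd (box_of U m) \<le> snd (box_of V m)"
    then have le: "i \<le> i'" "j \<le> j'"
      by (auto simp: u v)
    have tU: "is_tableau N lam U" and tV: "is_tableau N lam V"
      using U V by (auto simp: syt_def)
    have Uij: "U (i, j) = m" "(i, j) \<in> boxes lam" and Vij: "V (i', j') = m" "(i', j') \<in> boxes lam"
      using box_of_tableau[OF tU m] box_of_tableau[OF tV m] by (auto simp: u v)
    \<comment> \<open>The entry that \<open>V\<close> has where \<open>U\<close> has
      \<open>m\<close>. It is neither below nor equal to \<open>m\<close>, yet monotonicity of
      \<open>V\<close> bounds it by \<open>m\<close>.\<close>
    define n where "n = V (i, j)"
    have n: "n \<in> {1..N}"
      using Uij tV bij_betwE unfolding n_def is_tableau_def by blast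
    have box_n: "box_of V n = (i, j)"
      by (rule box_of_eqI[OF tV]) (use n in \<open>auto simp: n_def\<close>)
    have "\<not> n < m"
    proof
      assume "n < m"
      then have "box_of U n = (i, j)"
        using ag[of n] box_n n by simp
      then have "U (i, j) = n"
        using box_of_tableau(1)[OF tU n] by simp
      then show False
        using \<open>n < m\<close> Uij by simp
    qed
    moreover have "n \<noteq> m"
      using ne u box_n by auto
    \<comment> \<open>The corner \<open>(i, j')\<close> splits the comparison with
      \<open>V (i', j')\<close> into one move along a row and one along a column.\<close>
    moreover have "n \<le> V (i, j')"
    proof -
      have "(i, j') \<in> boxes lam"
        by (rule boxes_down_closed[OF lam Vij(2)]) (use le in auto)
      then show ?thesis
        using V Uij le by (cases "j = j'") (auto simp: syt_def n_def intro!: less_imp_le)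
    qed
    moreover have "V (i, j') \<le> V (i', j')"
    proof -
      have "(i, j') \<in> boxes lam"
        by (rule boxes_down_closed[OF lam Vij(2)]) (use le in auto)
      then show ?thesis
        using V Vij le by (cases "i = i'") (auto simp: syt_def intro!: less_imp_le)
    qed
    ultimately show False
      using Vij by simp
  qed
  show ?thesis
    using not_dominated[OF T S differ agree] not_dominated[OF S T differ[symmetric] agree[symmetric]]
    by linarith
qed

section \<open>Comparison of Yamanouchi symbols\<close>

lemma nth_yamanouchi:
  assumes "l < N"
  shows "yamanouchi N T ! l = Suc (fst (box_of T (Suc l)))"
  using assms by (simp add: yamanouchi_def del: upt_Suc)

lemma length_yamanouchi [simp]: "length (yamanouchi N T) = N"
  by (simp add: yamanouchi_def)

lemma yamanouchi_less:
  assumes "m \<in> {1..N}" "\<And>l. l \<in> {1..<m} \<Longrightarrow> box_of T l = box_of S l"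
    and "fst (box_of T m) < fst (box_of S m)"
  shows "yamanouchi N T < yamanouchi N S"
  \<comment> \<open>Entries start at 1 and list positions at 0, so \<open>m\<close> is recorded at
    position \<open>m - 1\<close>.\<close>
  by (rule list_less_at_first_difference[of "m - 1"]) (use assms in \<open>auto simp: nth_yamanouchi\<close>)

text \<open>The least entry placed differently decides both comparisons: by its rows for the
  tableaux, by its columns for their conjugates. These two orders are opposite by
  \<open>syt_first_difference\<close>.\<close>

lemma yamanouchi_conj_cases:
  assumes lam: "is_partition N lam" and T: "T \<in> syt N lam" and S: "S \<in> syt N lam" and "T \<noteq> S"
  shows "yamanouchi N T < yamanouchi N S \<and>
      yamanouchi N (conj_tableau S) < yamanouchi N (conj_tableau T) \<or>
    yamanouchi N S < yamanouchi N T \<and>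
      yamanouchi N (conj_tableau T) < yamanouchi N (conj_tableau S)"
proof -
  have tT: "is_tableau N lam T" and tS: "is_tableau N lam S"
    using T S by (auto simp: syt_def)
  define P where "P m \<longleftrightarrow> m \<in> {1..N} \<and> box_of T m \<noteq> box_of S m" for m
  have "\<exists>m. P m"
  proof -
    \<comment> \<open>Both tableaux vanish outside the diagram, so such a box lies inside it, and
      the entry \<open>T b\<close> has different positions in \<open>T\<close> and
      \<open>S\<close>.\<close>
    obtain b where b: "T b \<noteq> S b"
      using \<open>T \<noteq> S\<close> by blast
    then have "b \<in> boxes lam"
      using tT tS unfolding is_tableau_def by metis
    then have Tb: "T b \<in> {1..N}"
      using tT bij_betwE unfolding is_tableau_def by blast
    then have "box_of T (T b) = b"
      using box_of_eqI[OF tT] by simp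
    moreover have "box_of S (T b) \<noteq> b"
      using box_of_tableau(1)[OF tS Tb] b by auto
    ultimately show ?thesis
      using Tb P_def by metis
  qed
  define m where "m = (LEAST m. P m)"
  have m: "m \<in> {1..N}" "box_of T m \<noteq> box_of S m"
    using LeastI_ex[OF \<open>\<exists>m. P m\<close>] by (auto simp: m_def P_def)
  have agree: "box_of T l = box_of S l" if "l \<in> {1..<m}" for l
    using not_less_Least[of l P] that m(1) by (auto simp: m_def P_def)
  have c: "box_of (conj_tableau T) l = prod.swap (box_of T l)"
    "box_of (conj_tableau S) l = prod.swap (box_of S l)" if "l \<in> {1..m}" for l
    using that m(1) by (auto intro!: box_of_conj_tableau lam tT tS)
  have less: "yamanouchi N T < yamanouchi N S" if "fst (box_of T m) < fst (box_of S m)"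
    by (rule yamanouchi_less[OF m(1)]) (use that agree in auto)
  have less': "yamanouchi N S < yamanouchi N T" if "fst (box_of S m) < fst (box_of T m)"
    by (rule yamanouchi_less[OF m(1)]) (use that agree in auto)
  have conj_less: "yamanouchi N (conj_tableau T) < yamanouchi N (conj_tableau S)"
    if "snd (box_of T m) < snd (box_of S m)"
    by (rule yamanouchi_less[OF m(1)]) (use that agree c m(1) in auto)
  have conj_less': "yamanouchi N (conj_tableau S) < yamanouchi N (conj_tableau T)"
    if "snd (box_of S m) < snd (box_of T m)"
    by (rule yamanouchi_less[OF m(1)]) (use that agree c m(1) in auto)
  show ?thesis
    using syt_first_difference[OF lam T S m(1) agree m(2)] less less' conj_less conj_less' by blast
qed

lemma inj_on_yamanouchi:
  assumes "is_partition N lam"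
  shows "inj_on (yamanouchi N) (syt N lam)"
  by (rule inj_onI) (metis assms less_irrefl yamanouchi_conj_cases)

text \<open>
  The class constants \<^const>\<open>insort_key\<close> and \<^const>\<open>sorted_key_list_of_set\<close> are not
  syntactically the ones that an interpretation of \<^locale>\<open>folding_insort_key\<close> speaks about.
\<close>

lemma linorder_insort_key_eq:
  "linorder.insort_key ((\<le>) :: 'b :: linorder \<Rightarrow> _) f x xs = insort_key f x xs"
  by (induction xs) (simp_all add: linorder.insort_key.simps[OF linorder_class.linorder_axioms])

lemma linorder_sorted_key_list_of_set_eq:
  "linorder.sorted_key_list_of_set ((\<le>) :: 'b :: linorder \<Rightarrow> _) f = sorted_key_list_of_set f"
proof -
  have "linorder.insort_key ((\<le>) :: 'b \<Rightarrow> _) f = insort_key f"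
    by (intro ext) (rule linorder_insort_key_eq)
  then show ?thesis
    by (simp add: sorted_key_list_of_set_def
        linorder.sorted_key_list_of_set_def[OF linorder_class.linorder_axioms])
qed

lemma syt_list_props:
  assumes "is_partition N lam"
  shows "set (syt_list N lam) = syt N lam" "distinct (syt_list N lam)"
    "length (syt_list N lam) = dim_syt N lam"
    "sorted_wrt (<) (map (yamanouchi N) (syt_list N lam))"
proof -
  interpret folding_insort_key "(\<le>)" "(<)" "syt N lam" "yamanouchi N"
    rewrites "linorder.sorted_key_list_of_set (\<le>) (yamanouchi N) = sorted_key_list_of_set (yamanouchi N)"
    by (unfold_locales, rule inj_on_yamanouchi[OF assms], rule linorder_sorted_key_list_of_set_eq)
  show "set (syt_list N lam) = syt N lam" "length (syt_list N lam) = dim_syt N lam"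
    "sorted_wrt (<) (map (yamanouchi N) (syt_list N lam))"
    using finite_syt[OF assms] by (auto simp: syt_list_def dim_syt_def)
  show "distinct (syt_list N lam)"
    using distinct_sorted_key_list_of_set[OF subset_refl] by (simp add: syt_list_def distinct_map)
qed

text \<open>A finite set has only one listing with strictly increasing keys, and reversing the list
  of conjugates restores the increasing order. This reversal is the source of the anti-diagonal
  shape.\<close>

lemma syt_list_conj:
  assumes "is_partition N lam"
  shows "syt_list N (conj_partition lam) = rev (map conj_tableau (syt_list N lam))"
proof -
  interpret folding_insort_key "(\<le>)" "(<)" "syt N (conj_partition lam)" "yamanouchi N"
    rewrites "linorder.sorted_key_list_of_set (\<le>) (yamanouchi N) = sorted_key_list_of_set (yamanouchi N)"
    by (unfold_locales, rule inj_on_yamanouchi[OF is_partition_conj[OF assms]],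
        rule linorder_sorted_key_list_of_set_eq)
  note L = syt_list_props[OF assms]
  have "sorted_wrt (\<lambda>T S. yamanouchi N (conj_tableau S) < yamanouchi N (conj_tableau T)) (syt_list N lam)"
  proof (rule sorted_wrt_mono_rel)
    show "sorted_wrt (\<lambda>T S. yamanouchi N T < yamanouchi N S) (syt_list N lam)"
      using L(4) by (simp add: sorted_wrt_map)
  next
    fix T S
    assume "T \<in> set (syt_list N lam)" "S \<in> set (syt_list N lam)" "yamanouchi N T < yamanouchi N S"
    then show "yamanouchi N (conj_tableau S) < yamanouchi N (conj_tableau T)"
      using yamanouchi_conj_cases[OF assms, of T S] L(1) by fastforce
  qed
  then have "sorted_wrt (<) (map (yamanouchi N) (rev (map conj_tableau (syt_list N lam))))"
    by (simp add: sorted_wrt_map sorted_wrt_rev flip: rev_map)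
  moreover have "length (rev (map conj_tableau (syt_list N lam))) = card (syt N (conj_partition lam))"
    using L(3) dim_syt_conj[OF assms] by (simp add: dim_syt_def)
  moreover have "set (rev (map conj_tableau (syt_list N lam))) = syt N (conj_partition lam)"
    using L(1) syt_conj[OF assms] by simp
  moreover have "finite (syt N (conj_partition lam))"
    by (simp add: syt_conj[OF assms] finite_syt[OF assms])
  ultimately show ?thesis
    using sorted_key_list_of_set_unique[of "syt N (conj_partition lam)"] unfolding syt_list_def by blast
qed


section \<open>The permutation carrying one tableau to another\<close>

text \<open>Justifies the definite description in \<open>syt_perm\<close>. The equation determines
  \<open>p\<close> on every entry of \<open>T\<close>, and a permutation of \<open>{1..N}\<close>
  fixes everything else.\<close>

lemma ex1_permutes_tableau:
  assumes T: "is_tableau N lam T" and S: "is_tableau N lam S"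
  shows "\<exists>!p. p permutes {1..N} \<and> p \<circ> T = S"
proof -
  have T0: "T b = 0" and S0: "S b = 0" if "b \<notin> boxes lam" for b
    using T S that unfolding is_tableau_def by blast+
  \<comment> \<open>Read off the entry of \<open>S\<close> in the box where \<open>T\<close> has
    \<open>m\<close>. As \<open>p\<close> fixes 0, the equation \<open>p \<circ> T = S\<close> also
    holds outside the diagram.\<close>
  define p where "p m = (if m \<in> {1..N} then S (box_of T m) else m)" for m
  have pT: "p (T b) = S b" for b
  proof (cases "b \<in> boxes lam")
    case True
    then have "T b \<in> {1..N}"
      using T bij_betwE unfolding is_tableau_def by blast
    then show ?thesis
      using box_of_eqI[OF T refl] by (simp add: p_def)
  qed (simp add: T0 S0 p_def)
  have "bij_betw (p \<circ> T) (boxes lam) {1..N}"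
    using S pT by (simp add: is_tableau_def comp_def cong: bij_betw_cong)
  then have "bij_betw p {1..N} {1..N}"
    using bij_betw_comp_iff[of T "boxes lam" "{1..N}" p "{1..N}"] T by (simp add: is_tableau_def)
  then have "p permutes {1..N}"
    by (rule bij_imp_permutes) (auto simp: p_def)
  moreover have "p \<circ> T = S"
    using pT by auto
  moreover have "q = q'" if q: "q permutes {1..N}" "q \<circ> T = S"
    and q': "q' permutes {1..N}" "q' \<circ> T = S" for q q'
  proof
    fix m
    show "q m = q' m"
    proof (cases "m \<in> {1..N}")
      case True
      then show ?thesis
        using fun_cong[OF q(2), of "box_of T m"] fun_cong[OF q'(2), of "box_of T m"]
          box_of_tableau(1)[OF T True] by simp
    next
      case False
      then show ?thesis
        using q(1) q'(1) by (simp add: permutes_not_in)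
    qed
  qed
  ultimately show ?thesis
    by blast
qed

section \<open>The permutations from the first tableau and their signs\<close>

lemma nth_syt_list:
  assumes "is_partition N lam" "i < dim_syt N lam"
  shows "syt_list N lam ! i \<in> syt N lam" "is_tableau N lam (syt_list N lam ! i)"
  using syt_list_props[OF assms(1)] assms(2) nth_mem[of i "syt_list N lam"] by (auto simp: syt_def)

lemma syt_perm_eqI:
  assumes "is_partition N lam" "i < dim_syt N lam"
    and "p permutes {1..N}" "p \<circ> syt_list N lam ! 0 = syt_list N lam ! i"
  shows "syt_perm N lam i = p"
  unfolding syt_perm_def
  by (rule the1_equality[OF ex1_permutes_tableau[OF nth_syt_list(2) nth_syt_list(2)]])
    (use assms in auto)

lemma syt_perm_props:
  assumes "is_partition N lam" "i < dim_syt N lam"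
  shows "syt_perm N lam i permutes {1..N}"
    "syt_perm N lam i \<circ> syt_list N lam ! 0 = syt_list N lam ! i"
proof -
  have "0 < dim_syt N lam"
    using assms(2) by simp
  from theI'[OF ex1_permutes_tableau[OF nth_syt_list(2)[OF assms(1) this] nth_syt_list(2)[OF assms]]]
  show "syt_perm N lam i permutes {1..N}"
    "syt_perm N lam i \<circ> syt_list N lam ! 0 = syt_list N lam ! i"
    unfolding syt_perm_def by auto
qed

text \<open>By uniqueness, the permutation for \<open>j\<close> is the one for \<open>i\<close>
  followed by the transposition, which flips the sign.\<close>

lemma sign_syt_perm_transpose:
  assumes lam: "is_partition N lam" and i: "i < dim_syt N lam" and j: "j < dim_syt N lam"
    and ab: "a \<in> {1..N}" "b \<in> {1..N}" "a \<noteq> b"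
    and eq: "Transposition.transpose a b \<circ> syt_list N lam ! i = syt_list N lam ! j"
  shows "sign (syt_perm N lam j) = - sign (syt_perm N lam i)"
proof -
  note p = syt_perm_props[OF lam i]
  have "Transposition.transpose a b permutes {1..N}"
    by (rule permutes_swap_id[OF ab(1,2)])
  then have perm: "Transposition.transpose a b \<circ> syt_perm N lam i permutes {1..N}"
    by (rule permutes_compose[OF p(1)])
  have "syt_perm N lam j = Transposition.transpose a b \<circ> syt_perm N lam i"
    by (rule syt_perm_eqI[OF lam j perm]) (simp add: comp_assoc p(2) eq)
  moreover have "permutation (syt_perm N lam i)"
    using p(1) permutation_permutes by blast
  ultimately show ?thesis
    using ab by (simp add: sign_compose permutation_swap_id sign_swap_id)
qed

text \<open>Every permutation is a product of transpositions, and each transposition is a word in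
  adjacent ones. Multiplying by such a word one letter at a time reduces induction to the generators
  on which the representations are prescribed.\<close>

lemma permutes_adjacent_induct [consumes 1, case_names id transpose]:
  fixes N :: nat and P :: "(nat \<Rightarrow> nat) \<Rightarrow> bool"
  assumes "p permutes {1..N}" and id: "P id"
    and step: "\<And>k q. k \<in> {1..<N} \<Longrightarrow> q permutes {1..N} \<Longrightarrow> P q \<Longrightarrow>
      P (Transposition.transpose k (k + 1) \<circ> q)"
  shows "P p"
proof -
  have adj: "P (apply_adj_transps xs \<circ> q)" if "set xs \<subseteq> {1..<N}" "q permutes {1..N}" "P q" for xs q
    using that
  proof (induction xs)
    case (Cons x xs)
    have "apply_adj_transps xs \<circ> q permutes {1..N}"
      using Cons.prems by (intro permutes_compose permutes_apply_adj_transps) auto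
    moreover have "P (apply_adj_transps xs \<circ> q)"
      by (rule Cons.IH) (use Cons.prems in simp_all)
    ultimately have "P (Transposition.transpose x (x + 1) \<circ> (apply_adj_transps xs \<circ> q))"
      by (rule step[rotated]) (use Cons.prems in simp)
    then show ?case
      by (simp only: apply_adj_transps_Cons comp_assoc)
  qed simp
  have lt: "P (Transposition.transpose a b \<circ> q)"
    if "a \<in> {1..N}" "b \<in> {1..N}" "a < b" "q permutes {1..N}" "P q" for a b q
    using adj[of "adj_transp_seq a b" q] that by (auto simp: adj_transp_seq_correct set_adj_transp_seq)
  show ?thesis
    using assms(1) finite_atLeastAtMost[of 1 N]
  proof (induction rule: permutes_induct)
    case (swap a b p)
    then show ?case
      using lt[of a b p] lt[of b a p] by (metis linorder_neqE_nat transpose_commute)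
  qed (rule id)
qed


section \<open>Anti-diagonal matrices\<close>

lemma mult_mat_unit_vec:
  fixes A :: "'a :: semiring_1 mat"
  assumes "A \<in> carrier_mat n m" "i < m"
  shows "A *\<^sub>v unit_vec m i = col A i"
  by (rule eq_vecI) (use assms in auto)

lemma smult_mat_mult_vec:
  fixes A :: "'a :: comm_semiring_0 mat"
  assumes "A \<in> carrier_mat n m" "v \<in> carrier_vec m"
  shows "(c \<cdot>\<^sub>m A) *\<^sub>v v = c \<cdot>\<^sub>v (A *\<^sub>v v)"
  by (rule eq_vecI) (use assms in \<open>auto simp: smult_scalar_prod_distrib[of _ m]\<close>)

lemma mat_eqI_unit_vec:
  fixes A :: "'a :: semiring_1 mat"
  assumes "A \<in> carrier_mat n m" "B \<in> carrier_mat n m"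
    and "\<And>i. i < m \<Longrightarrow> A *\<^sub>v unit_vec m i = B *\<^sub>v unit_vec m i"
  shows "A = B"
  using assms by (intro mat_col_eqI) (auto simp: mult_mat_unit_vec)

text \<open>With indices from 0, the anti-diagonal is \<open>a + b + 1 = d\<close>. The coefficient
  depends on the column \<open>b\<close>, since column \<open>b\<close> holds the image of basis
  vector \<open>b\<close>.\<close>

definition antidiag :: "nat \<Rightarrow> (nat \<Rightarrow> complex) \<Rightarrow> complex mat" where
  "antidiag d e = mat d d (\<lambda>(a, b). if a + b + 1 = d then e b else 0)"

lemma antidiag_carrier [simp]: "antidiag d e \<in> carrier_mat d d"
  by (simp add: antidiag_def)

lemma antidiag_mult_unit_vec:
  assumes "i < d"
  shows "antidiag d e *\<^sub>v unit_vec d i = e i \<cdot>\<^sub>v unit_vec d (d - 1 - i)"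
  using assms by (subst mult_mat_unit_vec[OF antidiag_carrier assms]) (auto simp: antidiag_def intro!: eq_vecI)

lemma unitary_op_antidiag:
  assumes "\<And>i. i < d \<Longrightarrow> cnj (e i) * e i = 1"
  shows "unitary_op d d (antidiag d e)"
proof -
  have adj: "mat_adjoint (antidiag d e) =
      mat d d (\<lambda>(a, b). if a + b + 1 = d then cnj (e a) else 0)"
    by (rule eq_matI) (auto simp: mat_adjoint_def antidiag_def mat_of_rows_def)
  have "mat_adjoint (antidiag d e) * antidiag d e = 1\<^sub>m d"
  proof (rule eq_matI)
    fix a b assume "a < dim_row (1\<^sub>m d :: complex mat)" "b < dim_col (1\<^sub>m d :: complex mat)"
    then have ab: "a < d" "b < d"
      by auto
    then have "(mat_adjoint (antidiag d e) * antidiag d e) $$ (a, b) =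
        (\<Sum>c=0..<d. (if a + c + 1 = d then cnj (e a) else 0) * (if c + b + 1 = d then e b else 0))"
      by (simp add: adj) (simp add: antidiag_def scalar_prod_def)
    \<comment> \<open>The first factor forces \<open>c = d - 1 - a\<close>, and then the second is
      nonzero only if \<open>a = b\<close>.\<close>
    also have "\<dots> = (\<Sum>c=0..<d. if c = d - 1 - a then (if a = b then cnj (e a) * e a else 0) else 0)"
      by (rule sum.cong) (use ab in auto)
    also have "\<dots> = 1\<^sub>m d $$ (a, b)"
      using ab assms by (simp add: sum.delta')
    finally show "(mat_adjoint (antidiag d e) * antidiag d e) $$ (a, b) = 1\<^sub>m d $$ (a, b)" .
  qed (simp_all add: adj, simp add: antidiag_def)
  moreover from this have "antidiag d e * mat_adjoint (antidiag d e) = 1\<^sub>m d"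
    by (rule mat_mult_left_right_inverse[rotated 2]) (simp_all add: adj)
  ultimately show ?thesis
    by (simp add: unitary_op_def)
qed


section \<open>The representations\<close>

text \<open>Membership in \<open>hom\<close> gives closure and multiplicativity. The value at
  \<open>id\<close> follows because source and target are groups, the target being the units of the
  matrix ring.\<close>

lemma rep_props:
  assumes "young_yamanouchi_rep N lam D"
  shows "p permutes {1..N} \<Longrightarrow> D p \<in> carrier_mat (dim_syt N lam) (dim_syt N lam)"
    and "p permutes {1..N} \<Longrightarrow> q permutes {1..N} \<Longrightarrow> D (p \<circ> q) = D p * D q"
    and "D id = 1\<^sub>m (dim_syt N lam)"
proof -
  let ?R = "ring_mat TYPE(complex) (dim_syt N lam) ()"
  interpret R: ring ?R
    by (rule ring_mat)
  have hom: "D \<in> hom (sym_group N) (units_of ?R)"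
    using assms by (simp add: young_yamanouchi_rep_def)
  interpret group_hom "sym_group N" "units_of ?R" D
    using hom sym_group_is_group R.units_group by (simp add: group_hom_def group_hom_axioms_def)
  show "D p \<in> carrier_mat (dim_syt N lam) (dim_syt N lam)" if "p permutes {1..N}"
    using hom_closed[of p] that
    by (auto simp: sym_group_carrier units_of_carrier Units_def ring_mat_simps)
  show "D (p \<circ> q) = D p * D q" if "p permutes {1..N}" "q permutes {1..N}"
    using hom_mult[of p q] that by (simp add: sym_group_def units_of_mult ring_mat_simps)
  show "D id = 1\<^sub>m (dim_syt N lam)"
    using hom_one by (simp add: sym_group_def units_of_one ring_mat_simps)
qed

section \<open>Kets as unit vectors and the matrix of \<open>conj_op\<close>\<close>

lemma ket_syt_list:
  assumes "is_partition N lam" "i < dim_syt N lam"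
  shows "ket N lam (syt_list N lam ! i) = unit_vec (dim_syt N lam) i"
  using assms syt_list_props[OF assms(1)]
  by (intro eq_vecI) (auto simp: ket_def nth_eq_iff_index_eq)

lemma ket_conj_syt_list:
  assumes "is_partition N lam" "i < dim_syt N lam"
  shows "ket N (conj_partition lam) (conj_tableau (syt_list N lam ! i)) =
    unit_vec (dim_syt N lam) (dim_syt N lam - 1 - i)"
  using assms syt_list_props[OF assms(1)]
  by (intro eq_vecI)
    (auto simp: ket_def dim_syt_conj syt_list_conj rev_nth nth_eq_iff_index_eq)

text \<open>In column \<open>b\<close> only the summand \<open>i = b\<close> survives, and the
  conjugate of the tableau at position \<open>b\<close> sits at position \<open>d - 1 - b\<close> of
  the reversed list, where \<open>d = dim_syt N lam\<close>.\<close>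

lemma conj_op_eq_antidiag:
  assumes "is_partition N lam"
  shows "conj_op N lam = antidiag (dim_syt N lam) (\<lambda>i. of_int (sign (syt_perm N lam i)))"
proof (rule eq_matI)
  let ?d = "dim_syt N lam" and ?e = "\<lambda>i. complex_of_int (sign (syt_perm N lam i))"
  fix a b assume "a < dim_row (antidiag ?d ?e)" "b < dim_col (antidiag ?d ?e)"
  then have ab: "a < ?d" "b < ?d"
    by (auto simp: antidiag_def)
  have "conj_op N lam $$ (a, b) =
      (\<Sum>i<?d. ?e i * (unit_vec ?d (?d - 1 - i) $ a * conjugate (unit_vec ?d i $ b)))"
    using ab by (simp add: conj_op_def dim_syt_conj[OF assms] ket_syt_list[OF assms]
        ket_conj_syt_list[OF assms])
  also have "\<dots> = (\<Sum>i<?d. if i = b then (if a + b + 1 = ?d then ?e b else 0) else 0)"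
    by (rule sum.cong) (use ab in auto)
  also have "\<dots> = antidiag ?d ?e $$ (a, b)"
    using ab by (simp add: antidiag_def)
  finally show "conj_op N lam $$ (a, b) = antidiag ?d ?e $$ (a, b)" .
qed (simp_all add: conj_op_def antidiag_def dim_syt_conj[OF assms])

lemma conj_op_carrier [simp]:
  assumes "is_partition N lam"
  shows "conj_op N lam \<in> carrier_mat (dim_syt N lam) (dim_syt N lam)"
  by (simp add: conj_op_eq_antidiag[OF assms])

lemma conj_op_ket:
  assumes "is_partition N lam" "i < dim_syt N lam"
  shows "conj_op N lam *\<^sub>v ket N lam (syt_list N lam ! i) =
    of_int (sign (syt_perm N lam i)) \<cdot>\<^sub>v
      ket N (conj_partition lam) (conj_tableau (syt_list N lam ! i))"
  using assms
  by (simp add: conj_op_eq_antidiag ket_syt_list ket_conj_syt_list antidiag_mult_unit_vec)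

lemma unitary_conj_op:
  assumes "is_partition N lam"
  shows "unitary_op (dim_syt N lam) (dim_syt N (conj_partition lam)) (conj_op N lam)"
  unfolding conj_op_eq_antidiag[OF assms] dim_syt_conj[OF assms]
  by (rule unitary_op_antidiag) (simp add: sign_def)

text \<open>Both sides are compared on each \<open>|T\<rangle>\<close>, separating the diagonal term
  from the term in \<open>s \<circ> T\<close>.\<close>

lemma conj_op_intertwines_adjacent:
  assumes lam: "is_partition N lam" and D: "young_yamanouchi_rep N lam D"
    and D': "young_yamanouchi_rep N (conj_partition lam) D'" and k: "k \<in> {1..<N}"
  shows "D' (Transposition.transpose k (k + 1)) * conj_op N lam =
    (- 1) \<cdot>\<^sub>m (conj_op N lam * D (Transposition.transpose k (k + 1)))"
proof -
  let ?s = "Transposition.transpose k (k + 1)"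
  let ?d = "dim_syt N lam" and ?U = "conj_op N lam" and ?lam' = "conj_partition lam"
  have s: "?s permutes {1..N}"
    using k by (intro permutes_swap_id) auto
  define A B where "A = D ?s" and "B = D' ?s"
  have C [simp]: "A \<in> carrier_mat ?d ?d" "B \<in> carrier_mat ?d ?d" "?U \<in> carrier_mat ?d ?d"
    using rep_props(1)[OF D s] rep_props(1)[OF D' s] lam
    by (simp_all only: A_def B_def dim_syt_conj conj_op_carrier)
  have ket_carrier [simp]: "ket N lam T \<in> carrier_vec ?d" "ket N ?lam' T \<in> carrier_vec ?d" for T
    by (simp_all add: ket_def dim_syt_conj[OF lam])
  have "B * ?U = (- 1) \<cdot>\<^sub>m (?U * A)"
  proof (rule mat_eqI_unit_vec[of _ ?d ?d])
    fix i assume i: "i < ?d"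
    define T where "T = syt_list N lam ! i"
    define e where "e = complex_of_int (sign (syt_perm N lam i))"
    define r where "r = real_of_int (axial_distance T (k + 1) k)"
    define c where "c = complex_of_real (sqrt (1 - 1 / r\<^sup>2))"
    define v where "v = ket N ?lam' (conj_tableau T)"
    \<comment> \<open>\<open>w\<close> and \<open>w'\<close> are the off-diagonal parts of the
      action on \<open>T\<close> and on its conjugate. They share the coefficient \<open>c\<close>,
      in which the axial distance occurs only squared, and vanish together when
      \<open>?s \<circ> T\<close> is not standard.\<close>
    define w where "w = (if ?s \<circ> T \<in> syt N lam then c \<cdot>\<^sub>v ket N lam (?s \<circ> T) else 0\<^sub>v ?d)"
    define w' where "w' = (if ?s \<circ> T \<in> syt N lam then c \<cdot>\<^sub>v ket N ?lam' (conj_tableau (?s \<circ> T)) else 0\<^sub>v ?d)"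
    have T: "T \<in> syt N lam" "is_tableau N lam T"
      using nth_syt_list[OF lam i] by (auto simp: T_def)
    have [simp]: "v \<in> carrier_vec ?d" "w \<in> carrier_vec ?d" "w' \<in> carrier_vec ?d"
      by (simp_all add: v_def w_def w'_def)
    then have dims: "dim_vec v = ?d" "dim_vec w' = ?d"
      by simp_all
    have U_ket: "?U *\<^sub>v ket N lam T = e \<cdot>\<^sub>v v"
      using conj_op_ket[OF lam i] by (simp add: T_def e_def v_def)
    have Ds: "A *\<^sub>v ket N lam T = complex_of_real (1 / r) \<cdot>\<^sub>v ket N lam T + w"
      using D k T(1) unfolding young_yamanouchi_rep_def Let_def A_def w_def c_def r_def by blast
    have axial: "axial_distance (conj_tableau T) (k + 1) k = - axial_distance T (k + 1) k"
      by (rule axial_distance_conj_tableau[OF lam T(2)]) (use k in auto)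
    have "conj_tableau T \<in> syt N ?lam'"
      using T(1) by (simp add: conj_tableau_in_syt_iff[OF lam])
    moreover define r' where "r' = real_of_int (axial_distance (conj_tableau T) (k + 1) k)"
    ultimately have "B *\<^sub>v v = complex_of_real (1 / r') \<cdot>\<^sub>v v +
        (if ?s \<circ> conj_tableau T \<in> syt N ?lam'
         then complex_of_real (sqrt (1 - 1 / r'\<^sup>2)) \<cdot>\<^sub>v ket N ?lam' (?s \<circ> conj_tableau T)
         else 0\<^sub>v (dim_syt N ?lam'))"
      using D' k unfolding young_yamanouchi_rep_def Let_def B_def v_def by blast
    moreover have "r' = - r"
      unfolding r'_def r_def axial by simp
    ultimately have D's: "B *\<^sub>v v = complex_of_real (- (1 / r)) \<cdot>\<^sub>v v + w'"
      by (simp add: w'_def c_def dim_syt_conj[OF lam] conj_tableau_in_syt_iff[OF lam]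
          flip: conj_tableau_comp)
    \<comment> \<open>The minus sign is the change of sign between the permutations leading to
      \<open>T\<close> and to \<open>?s \<circ> T\<close>.\<close>
    have Uw: "?U *\<^sub>v w = (- e) \<cdot>\<^sub>v w'"
    proof (cases "?s \<circ> T \<in> syt N lam")
      case True
      then obtain j where j: "j < ?d" "syt_list N lam ! j = ?s \<circ> T"
        using syt_list_props[OF lam] by (metis in_set_conv_nth)
      have "sign (syt_perm N lam j) = - sign (syt_perm N lam i)"
        by (rule sign_syt_perm_transpose[OF lam i j(1)]) (use k j(2) in \<open>auto simp: T_def\<close>)
      then have "?U *\<^sub>v ket N lam (?s \<circ> T) = (- e) \<cdot>\<^sub>v ket N ?lam' (conj_tableau (?s \<circ> T))"
        using conj_op_ket[OF lam j(1)] by (simp add: e_def j(2))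
      then show ?thesis
        using True by (simp add: w_def w'_def mult_mat_vec[OF C(3)] smult_smult_assoc mult.commute)
    next
      case False
      then show ?thesis
        using carrier_matD[OF C(3)] by (auto simp: w_def w'_def intro!: eq_vecI)
    qed
    have "(B * ?U) *\<^sub>v ket N lam T = e \<cdot>\<^sub>v (complex_of_real (- (1 / r)) \<cdot>\<^sub>v v + w')"
      by (simp add: assoc_mult_mat_vec[OF C(2,3)] U_ket mult_mat_vec[OF C(2)] D's)
    \<comment> \<open>The minus sign of the axial distance in the diagonal term and that of the
      permutation in the other term combine into one common factor.\<close>
    also have "\<dots> = (- 1) \<cdot>\<^sub>v (complex_of_real (1 / r) \<cdot>\<^sub>v (e \<cdot>\<^sub>v v) + (- e) \<cdot>\<^sub>v w')"
      by (rule eq_vecI) (auto simp: dims algebra_simps)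
    also have "\<dots> = ((- 1) \<cdot>\<^sub>m (?U * A)) *\<^sub>v ket N lam T"
    proof -
      have "((- 1) \<cdot>\<^sub>m (?U * A)) *\<^sub>v ket N lam T = (- 1) \<cdot>\<^sub>v ((?U * A) *\<^sub>v ket N lam T)"
        by (rule smult_mat_mult_vec[OF mult_carrier_mat[OF C(3,1)] ket_carrier(1)])
      also have "(?U * A) *\<^sub>v ket N lam T = complex_of_real (1 / r) \<cdot>\<^sub>v (e \<cdot>\<^sub>v v) + (- e) \<cdot>\<^sub>v w'"
        by (simp add: assoc_mult_mat_vec[OF C(3,1)] Ds mult_add_distrib_mat_vec[OF C(3)]
            mult_mat_vec[OF C(3)] U_ket Uw)
      finally show ?thesis ..
    qed
    finally show "(B * ?U) *\<^sub>v unit_vec ?d i = ((- 1) \<cdot>\<^sub>m (?U * A)) *\<^sub>v unit_vec ?d i"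
      by (simp add: T_def ket_syt_list[OF lam i])
  qed (use mult_carrier_mat[OF C(2,3)] mult_carrier_mat[OF C(3,1)] in simp_all)
  then show ?thesis
    by (simp only: A_def B_def)
qed

text \<open>The relation passes to products by associativity, each adjacent transposition
  contributing a factor -1 that \<open>sign\<close> absorbs.\<close>

lemma conj_op_intertwines:
  assumes lam: "is_partition N lam" and D: "young_yamanouchi_rep N lam D"
    and D': "young_yamanouchi_rep N (conj_partition lam) D'" and p: "p permutes {1..N}"
  shows "D' p * conj_op N lam = of_int (sign p) \<cdot>\<^sub>m (conj_op N lam * D p)"
  using p
proof (induction rule: permutes_adjacent_induct)
  case id
  have C: "conj_op N lam \<in> carrier_mat (dim_syt N lam) (dim_syt N lam)"
    by (simp add: lam)
  then show ?case
    unfolding rep_props(3)[OF D] rep_props(3)[OF D'] dim_syt_conj[OF lam] sign_id by auto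
next
  case (transpose k q)
  let ?s = "Transposition.transpose k (k + 1)"
  let ?d = "dim_syt N lam" and ?U = "conj_op N lam"
  have s: "?s permutes {1..N}"
    using transpose by (intro permutes_swap_id) auto
  have C: "D ?s \<in> carrier_mat ?d ?d" "D' ?s \<in> carrier_mat ?d ?d" "?U \<in> carrier_mat ?d ?d"
    "D q \<in> carrier_mat ?d ?d" "D' q \<in> carrier_mat ?d ?d"
    using rep_props(1)[OF D] rep_props(1)[OF D'] s transpose lam by (simp_all add: dim_syt_conj)
  have sgn: "sign (?s \<circ> q) = - sign q"
    using transpose permutation_permutes[of q]
    by (subst sign_compose) (auto simp: permutation_swap_id sign_swap_id)
  have "D' (?s \<circ> q) * ?U = D' ?s * (of_int (sign q) \<cdot>\<^sub>m (?U * D q))"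
    using rep_props(2)[OF D' s] transpose C by (simp add: assoc_mult_mat[of _ ?d ?d _ ?d _ ?d])
  also have "\<dots> = of_int (sign q) \<cdot>\<^sub>m ((D' ?s * ?U) * D q)"
    using C by (simp add: mult_smult_distrib[of _ ?d ?d _ ?d] assoc_mult_mat[of _ ?d ?d _ ?d _ ?d])
  also have "D' ?s * ?U = (- 1) \<cdot>\<^sub>m (?U * D ?s)"
    using conj_op_intertwines_adjacent[OF lam D D'] transpose by simp
  also have "of_int (sign q) \<cdot>\<^sub>m ((- 1) \<cdot>\<^sub>m (?U * D ?s) * D q) =
      of_int (sign (?s \<circ> q)) \<cdot>\<^sub>m (?U * (D ?s * D q))"
    unfolding sgn using C
    by (auto simp: mult_smult_assoc_mat[of _ ?d ?d _ ?d] assoc_mult_mat[of _ ?d ?d _ ?d _ ?d])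
  also have "D ?s * D q = D (?s \<circ> q)"
    using rep_props(2)[OF D s] transpose by simp
  finally show ?case .
qed

text \<open>Since kets are unit vectors, the prescribed combination is row \<open>i\<close> of
  \<open>A\<close>, while the image of the ket at position \<open>i\<close> is column
  \<open>i\<close> of \<open>B\<close>.\<close>

lemma is_row_matrix_of_iff:
  assumes lam: "is_partition N lam" and mu: "is_partition N mu"
    and B: "B \<in> carrier_mat (dim_syt N mu) (dim_syt N lam)"
  shows "is_row_matrix_of N lam mu B A \<longleftrightarrow> A = transpose_mat B"
proof (cases "A \<in> carrier_mat (dim_syt N lam) (dim_syt N mu)")
  case True
  have "finsum_vec TYPE(complex) (dim_syt N mu)
      (\<lambda>j. A $$ (i, j) \<cdot>\<^sub>v ket N mu (syt_list N mu ! j)) {..<dim_syt N mu} = row A i"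
    if "i < dim_syt N lam" for i
  proof (rule eq_vecI)
    fix l assume "l < dim_vec (row A i)"
    then have l: "l < dim_syt N mu"
      using True by simp
    then have "finsum_vec TYPE(complex) (dim_syt N mu)
        (\<lambda>j. A $$ (i, j) \<cdot>\<^sub>v ket N mu (syt_list N mu ! j)) {..<dim_syt N mu} $ l =
      (\<Sum>j<dim_syt N mu. (A $$ (i, j) \<cdot>\<^sub>v ket N mu (syt_list N mu ! j)) $ l)"
      by (intro index_finsum_vec) (auto simp: ket_def)
    also have "\<dots> = (\<Sum>j<dim_syt N mu. if j = l then A $$ (i, j) else 0)"
      using l by (intro sum.cong) (auto simp: ket_syt_list[OF mu])
    also have "\<dots> = row A i $ l"
      using l True that by simp
    finally show "finsum_vec TYPE(complex) (dim_syt N mu)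
        (\<lambda>j. A $$ (i, j) \<cdot>\<^sub>v ket N mu (syt_list N mu ! j)) {..<dim_syt N mu} $ l = row A i $ l" .
  next
    have "finsum_vec TYPE(complex) (dim_syt N mu)
        (\<lambda>j. A $$ (i, j) \<cdot>\<^sub>v ket N mu (syt_list N mu ! j)) {..<dim_syt N mu} \<in>
        carrier_vec (dim_syt N mu)"
      by (intro finsum_vec_closed) (auto simp: ket_def)
    then show "dim_vec (finsum_vec TYPE(complex) (dim_syt N mu)
        (\<lambda>j. A $$ (i, j) \<cdot>\<^sub>v ket N mu (syt_list N mu ! j)) {..<dim_syt N mu}) = dim_vec (row A i)"
      using True by simp
  qed
  moreover have "B *\<^sub>v ket N lam (syt_list N lam ! i) = col B i" if "i < dim_syt N lam" for i
    using B that by (simp add: ket_syt_list[OF lam] mult_mat_unit_vec)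
  ultimately have "is_row_matrix_of N lam mu B A \<longleftrightarrow> (\<forall>i < dim_syt N lam. col B i = row A i)"
    using True by (simp add: is_row_matrix_of_def)
  also have "\<dots> \<longleftrightarrow> A = transpose_mat B"
    using True B by (auto intro!: eq_rowI)
  finally show ?thesis .
qed (use B in \<open>auto simp: is_row_matrix_of_def\<close>)

theorem theoremV16:
  fixes N :: nat
    and lam :: "nat \<Rightarrow> nat"
    and D D' :: "(nat \<Rightarrow> nat) \<Rightarrow> complex mat"
  assumes "N \<ge> 1"
    and "is_partition N lam"
    and "young_yamanouchi_rep N lam D"
    and "young_yamanouchi_rep N (conj_partition lam) D'"
  shows "(\<forall>i < dim_syt N lam.
            conj_op N lam *\<^sub>v ket N lam (syt_list N lam ! i) =
              of_int (sign (syt_perm N lam i)) \<cdot>\<^sub>v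
                ket N (conj_partition lam) (conj_tableau (syt_list N lam ! i)))
      \<and> unitary_op (dim_syt N lam) (dim_syt N (conj_partition lam)) (conj_op N lam)
      \<and> (\<forall>p. p permutes {1..N} \<longrightarrow>
            D' p = of_int (sign p) \<cdot>\<^sub>m (conj_op N lam * D p * mat_adjoint (conj_op N lam)))
      \<and> (\<forall>A. is_row_matrix_of N lam (conj_partition lam) (conj_op N lam) A \<longleftrightarrow>
            A = mat (dim_syt N lam) (dim_syt N lam) (\<lambda>(i, j).
                  if i + j + 1 = dim_syt N lam then of_int (sign (syt_perm N lam i)) else 0))"
proof (intro conjI allI impI)
  let ?d = "dim_syt N lam" and ?U = "conj_op N lam"
  note lam = assms(2)
  show "?U *\<^sub>v ket N lam (syt_list N lam ! i) =
      of_int (sign (syt_perm N lam i)) \<cdot>\<^sub>v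
        ket N (conj_partition lam) (conj_tableau (syt_list N lam ! i))" if "i < ?d" for i
    by (rule conj_op_ket[OF lam that])
  show unitary: "unitary_op ?d (dim_syt N (conj_partition lam)) ?U"
    by (rule unitary_conj_op[OF lam])
  show "D' p = of_int (sign p) \<cdot>\<^sub>m (?U * D p * mat_adjoint ?U)" if p: "p permutes {1..N}" for p
  proof -
    have UU: "?U * mat_adjoint ?U = 1\<^sub>m ?d"
      using unitary by (simp add: unitary_op_def dim_syt_conj[OF lam])
    have C: "D p \<in> carrier_mat ?d ?d" "D' p \<in> carrier_mat ?d ?d" "?U \<in> carrier_mat ?d ?d"
      "mat_adjoint ?U \<in> carrier_mat ?d ?d"
      using rep_props(1)[OF assms(3) p] rep_props(1)[OF assms(4) p] conj_op_carrier[OF lam]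
      by (auto simp: dim_syt_conj[OF lam] mat_adjoint_def)
    \<comment> \<open>Inserting \<open>?U * mat_adjoint ?U = 1\<close> turns the intertwining
      relation into the similarity.\<close>
    have "D' p = (D' p * ?U) * mat_adjoint ?U"
      using C by (simp add: assoc_mult_mat[of _ ?d ?d _ ?d _ ?d] UU)
    also have "D' p * ?U = of_int (sign p) \<cdot>\<^sub>m (?U * D p)"
      by (rule conj_op_intertwines[OF lam assms(3,4) p])
    finally show ?thesis
      using C by (simp add: mult_smult_assoc_mat[of _ ?d ?d _ ?d])
  qed
  show "is_row_matrix_of N lam (conj_partition lam) ?U A \<longleftrightarrow>
      A = mat ?d ?d (\<lambda>(i, j).
        if i + j + 1 = ?d then of_int (sign (syt_perm N lam i)) else 0)" for A
  proof -
    \<comment> \<open>The row convention transposes the operator matrix, so the sign attached to a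
      column is now attached to row \<open>i\<close>.\<close>
    have "transpose_mat ?U = mat ?d ?d (\<lambda>(i, j).
        if i + j + 1 = ?d then of_int (sign (syt_perm N lam i)) else 0)"
      by (rule eq_matI) (auto simp: conj_op_eq_antidiag[OF lam] antidiag_def add.commute)
    then show ?thesis
      using is_row_matrix_of_iff[OF lam is_partition_conj[OF lam], of ?U A] conj_op_carrier[OF lam]
      by (simp add: dim_syt_conj[OF lam])
  qed
qed

end
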